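(* Let $X$ and $Y$ be Banach spaces and let $Z=X\oplus_\infty Y$. Then $Z$ has $BHP$ if and only if both $X$ and $Y$ have $BHP$.
   Context: All Banach spaces are real and nontrivial. For a Banach space $E$, $B_E$ is the closed unit ball. $E$ has the Ball Huskable Property ($BHP$) if for every $\varepsilon>0$ there is a nonempty relatively weakly open subset of $B_E$ with diameter less than $\varepsilon$. $X\oplus_\infty Y$ is $X\times Y$ with norm $\|(x,y)\|=\max\{\|x\|,\|y\|\}$. *)

theory Defs
  imports "HOL-Analysis.Analysis"
begin

text \<open>
  The library's product type carries the Euclidean norm, so the \<open>\<ell>\<^sub>\<infinity>\<close>-sum of two spaces
  is introduced as a type of its own.
\<close>

datatype ('a, 'b) linf_sum (infixr \<open>\<oplus>\<^sub>\<infinity>\<close> 21) = LInf (linf_fst: 'a) (linf_snd: 'b)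

instantiation linf_sum :: (real_vector, real_vector) real_vector
begin

definition zero_linf_sum :: "'a \<oplus>\<^sub>\<infinity> 'b" where
  "0 = LInf 0 0"
definition plus_linf_sum :: "'a \<oplus>\<^sub>\<infinity> 'b \<Rightarrow> 'a \<oplus>\<^sub>\<infinity> 'b \<Rightarrow> 'a \<oplus>\<^sub>\<infinity> 'b" where
  "z + w = LInf (linf_fst z + linf_fst w) (linf_snd z + linf_snd w)"
definition minus_linf_sum :: "'a \<oplus>\<^sub>\<infinity> 'b \<Rightarrow> 'a \<oplus>\<^sub>\<infinity> 'b \<Rightarrow> 'a \<oplus>\<^sub>\<infinity> 'b" where
  "z - w = LInf (linf_fst z - linf_fst w) (linf_snd z - linf_snd w)"
definition uminus_linf_sum :: "'a \<oplus>\<^sub>\<infinity> 'b \<Rightarrow> 'a \<oplus>\<^sub>\<infinity> 'b" where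
  "- z = LInf (- linf_fst z) (- linf_snd z)"
definition scaleR_linf_sum :: "real \<Rightarrow> 'a \<oplus>\<^sub>\<infinity> 'b \<Rightarrow> 'a \<oplus>\<^sub>\<infinity> 'b" where
  "r *\<^sub>R z = LInf (r *\<^sub>R linf_fst z) (r *\<^sub>R linf_snd z)"

instance
  by standard
    (simp_all add: zero_linf_sum_def plus_linf_sum_def minus_linf_sum_def uminus_linf_sum_def
      scaleR_linf_sum_def algebra_simps linf_sum.expand)

end

instantiation linf_sum :: (real_normed_vector, real_normed_vector) real_normed_vector
begin

definition norm_linf_sum :: "'a \<oplus>\<^sub>\<infinity> 'b \<Rightarrow> real" where
  "norm z = max (norm (linf_fst z)) (norm (linf_snd z))"
definition sgn_linf_sum_def:
  "sgn (z :: 'a \<oplus>\<^sub>\<infinity> 'b) = inverse (norm z) *\<^sub>R z"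
definition dist_linf_sum_def:
  "dist (z :: 'a \<oplus>\<^sub>\<infinity> 'b) w = norm (z - w)"
definition uniformity_linf_sum_def:
  "uniformity = (INF e\<in>{0 <..}. principal {(z :: 'a \<oplus>\<^sub>\<infinity> 'b, w). dist z w < e})"
definition open_linf_sum_def:
  "open (U :: ('a \<oplus>\<^sub>\<infinity> 'b) set) \<longleftrightarrow> (\<forall>z\<in>U. eventually (\<lambda>(z', w). z' = z \<longrightarrow> w \<in> U) uniformity)"

instance
proof
  fix z w :: "'a \<oplus>\<^sub>\<infinity> 'b" and r :: real
  show "dist z w = norm (z - w)" by (rule dist_linf_sum_def)
  show "sgn z = inverse (norm z) *\<^sub>R z" by (rule sgn_linf_sum_def)
  show "(norm z = 0) = (z = 0)"
  proof
    assume "norm z = 0"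
    then have "norm (linf_fst z) \<le> 0" "norm (linf_snd z) \<le> 0"
      unfolding norm_linf_sum_def by linarith+
    then show "z = 0"
      by (simp add: zero_linf_sum_def linf_sum.expand)
  qed (simp add: norm_linf_sum_def zero_linf_sum_def)
  show "norm (z + w) \<le> norm z + norm w"
    using norm_triangle_ineq[of "linf_fst z" "linf_fst w"]
      norm_triangle_ineq[of "linf_snd z" "linf_snd w"]
    by (simp add: norm_linf_sum_def plus_linf_sum_def) linarith
  show "norm (r *\<^sub>R z) = \<bar>r\<bar> * norm z"
    by (simp add: norm_linf_sum_def scaleR_linf_sum_def max_mult_distrib_left)
qed (rule uniformity_linf_sum_def open_linf_sum_def)+

end

instance linf_sum :: (banach, banach) banach
proof
  fix f :: "nat \<Rightarrow> 'a \<oplus>\<^sub>\<infinity> 'b"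
  assume f: "Cauchy f"
  have le: "dist (linf_fst z) (linf_fst w) \<le> dist z w" "dist (linf_snd z) (linf_snd w) \<le> dist z w"
    for z w :: "'a \<oplus>\<^sub>\<infinity> 'b"
    by (simp_all add: dist_norm norm_linf_sum_def minus_linf_sum_def)
  have "Cauchy (\<lambda>n. linf_fst (f n))" "Cauchy (\<lambda>n. linf_snd (f n))"
    using f le unfolding Cauchy_def by (meson le_less_trans)+
  then obtain x y where x: "(\<lambda>n. linf_fst (f n)) \<longlonglongrightarrow> x" and y: "(\<lambda>n. linf_snd (f n)) \<longlonglongrightarrow> y"
    by (metis Cauchy_convergent convergent_def)
  have "f \<longlonglongrightarrow> LInf x y"
  proof (rule metric_LIMSEQ_I)
    fix e :: real
    assume "0 < e"
    from metric_LIMSEQ_D[OF x this] metric_LIMSEQ_D[OF y this]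
    obtain M N where "\<forall>n\<ge>M. dist (linf_fst (f n)) x < e" "\<forall>n\<ge>N. dist (linf_snd (f n)) y < e"
      by blast
    then show "\<exists>K. \<forall>n\<ge>K. dist (f n) (LInf x y) < e"
      by (intro exI[of _ "max M N"])
        (simp add: dist_norm norm_linf_sum_def minus_linf_sum_def)
  qed
  then show "convergent f"
    by (rule convergentI)
qed

definition weak_topology :: "'a::real_normed_vector topology" where
  "weak_topology =
    topology_generated_by {f -` S |f S. bounded_linear (f :: 'a \<Rightarrow> real) \<and> open S}"

definition BHP :: "'a::real_normed_vector itself \<Rightarrow> bool" where
  "BHP _ \<longleftrightarrow> (\<forall>\<epsilon>>0. \<exists>U :: 'a set.
     openin (subtopology weak_topology (cball 0 1)) U \<and> U \<noteq> {} \<and> diameter U < \<epsilon>)"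

end

theory Submission
  imports Defs
begin

text \<open>
  The unit ball of \<open>X \<oplus>\<^sub>\<infinity> Y\<close> is the product of the unit balls. Hence a product of relatively weakly
  open sets of small diameter is such a set again, and conversely the section through any point
  of a small relatively weakly open set, parallel to a summand, is relatively weakly open in the
  ball of that summand and no larger in diameter.
\<close>

lemma topspace_weak_topology [simp]: "topspace weak_topology = UNIV"
proof -
  have "UNIV \<in> {f -` S |f S. bounded_linear (f :: 'a \<Rightarrow> real) \<and> open S}"
    by (rule CollectI, rule exI[of _ "\<lambda>_. 0"], rule exI[of _ UNIV]) (simp add: bounded_linear_zero)
  then show ?thesis
    unfolding weak_topology_def topology_generated_by_topspace by blast
qed

text \<open>Weak continuity need only be tested on the generating sets. The shift by
  \<open>c\<close> is allowed because sections run along translates of a summand.\<close>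

lemma continuous_map_weak_affine:
  assumes "bounded_linear T"
  shows "continuous_map weak_topology weak_topology (\<lambda>x. T x + c)"
  unfolding weak_topology_def[where ?'a = 'b]
proof (rule continuous_on_generated_topo)
  fix U :: "'b set"
  assume "U \<in> {f -` S |f S. bounded_linear (f :: 'b \<Rightarrow> real) \<and> open S}"
  then obtain f :: "'b \<Rightarrow> real" and S where f: "bounded_linear f" and S: "open S" and U: "U = f -` S"
    by blast
  \<comment> \<open>The constant \<open>f c\<close> is absorbed by translating \<open>S\<close>;
    what remains is a preimage under the functional \<open>f (T x)\<close>, again a
    generator.\<close>
  have "(\<lambda>x. T x + c) -` U = (\<lambda>x. f (T x)) -` ((+) (- f c) ` S)"
    using f unfolding U by (force simp: linear_simps image_iff)
  moreover have "openin weak_topology ((\<lambda>x. f (T x)) -` ((+) (- f c) ` S))"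
    unfolding weak_topology_def
    by (rule topology_generated_by_Basis)
      (use bounded_linear_compose[OF f assms] open_translation[OF S, of "- f c"] in blast)
  ultimately show "openin weak_topology ((\<lambda>x. T x + c) -` U \<inter> topspace weak_topology)"
    by simp
next
  have "UNIV = \<Union> {f -` S |f S. bounded_linear (f :: 'b \<Rightarrow> real) \<and> open S}"
    using topspace_weak_topology
    unfolding weak_topology_def topology_generated_by_topspace by (rule sym)
  then show "(\<lambda>x. T x + c) ` topspace weak_topology
      \<subseteq> \<Union> {f -` S |f S. bounded_linear (f :: 'b \<Rightarrow> real) \<and> open S}"
    by blast
qed

lemma openin_weak_vimage_affine:
  assumes "bounded_linear T" "openin weak_topology V"
  shows "openin weak_topology ((\<lambda>x. T x + c) -` V)"
  using openin_continuous_map_preimage[OF continuous_map_weak_affine[OF assms(1)] assms(2), of c]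
  by (simp add: vimage_def)

text \<open>Treats both summands at once: \<open>T\<close> stands for the embedding of a summand and
  \<open>P\<close> for the coordinate projection onto it. The hypothesis \<open>fibre\<close> is
  where the max norm enters: exchanging one coordinate of a ball point for any point of the
  summand's ball stays in the ball.\<close>

lemma BHP_section:
  fixes T :: "'a::real_normed_vector \<Rightarrow> 'b::real_normed_vector"
  assumes BHP: "BHP TYPE('b)"
    and T: "bounded_linear T" and isometry: "\<And>x. norm (T x) = norm x"
    and P: "\<And>z. norm z \<le> 1 \<Longrightarrow> norm (P z) \<le> 1"
    and fibre: "\<And>x z. \<lbrakk>norm x \<le> 1; norm z \<le> 1\<rbrakk> \<Longrightarrow> norm (T x + (z - T (P z))) \<le> 1"
  shows "BHP TYPE('a)"
  unfolding BHP_def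
proof (intro allI impI)
  fix \<epsilon> :: real
  assume "\<epsilon> > 0"
  then obtain U :: "'b set" where U: "openin (subtopology weak_topology (cball 0 1)) U"
    and "U \<noteq> {}" and diam: "diameter U < \<epsilon>"
    using BHP unfolding BHP_def by blast
  then obtain z where z: "z \<in> U"
    by blast
  obtain V where V: "openin weak_topology V" and U_eq: "U = V \<inter> cball 0 1"
    using U by (auto simp: openin_subtopology)
  \<comment> \<open>The part of \<open>z\<close> complementary to the summand, so that
    \<open>T (P z) + c = z\<close>; hence \<open>P z\<close> witnesses that \<open>W\<close> is
    nonempty.\<close>
  define c where "c = z - T (P z)"
  define W where "W = (\<lambda>x. T x + c) -` V \<inter> cball 0 1"
  have into: "T x + c \<in> U" if "x \<in> W" for x
    using that z fibre[of x z] by (auto simp: W_def U_eq c_def)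
  \<comment> \<open>Only for a bounded set is \<open>diameter\<close> known to dominate all
    distances.\<close>
  have "bounded U"
    unfolding U_eq by (intro bounded_Int) simp
  have "P z \<in> W"
    using z P[of z] by (auto simp: W_def U_eq c_def)
  moreover have "diameter W \<le> diameter U"
  proof (rule diameter_le)
    show "W \<noteq> {} \<or> 0 \<le> diameter U"
      using \<open>P z \<in> W\<close> by blast
    show "norm (x - y) \<le> diameter U" if "x \<in> W" "y \<in> W" for x y
    proof -
      \<comment> \<open>The shift \<open>c\<close> cancels and \<open>T\<close> is isometric, so
        \<open>W\<close> embeds into \<open>U\<close> with distances preserved.\<close>
      have "norm (x - y) = dist (T x + c) (T y + c)"
        using isometry[of "x - y"] by (simp add: dist_norm linear_simps(2)[OF T])
      also have "\<dots> \<le> diameter U"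
        using diameter_bounded_bound[OF \<open>bounded U\<close>] into that by blast
      finally show ?thesis .
    qed
  qed
  moreover have "openin (subtopology weak_topology (cball 0 1)) W"
    unfolding W_def openin_subtopology using openin_weak_vimage_affine[OF T V] by blast
  ultimately show "\<exists>W :: 'a set. openin (subtopology weak_topology (cball 0 1)) W \<and> W \<noteq> {} \<and>
      diameter W < \<epsilon>"
    using diam by (intro exI[of _ W]) auto
qed

lemma bounded_linear_linf_fst:
  "bounded_linear (linf_fst :: ('a::real_normed_vector \<oplus>\<^sub>\<infinity> 'b::real_normed_vector) \<Rightarrow> 'a)"
  by (rule bounded_linear_intro[where K = 1])
    (simp_all add: plus_linf_sum_def scaleR_linf_sum_def norm_linf_sum_def)

lemma bounded_linear_linf_snd:
  "bounded_linear (linf_snd :: ('a::real_normed_vector \<oplus>\<^sub>\<infinity> 'b::real_normed_vector) \<Rightarrow> 'b)"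
  by (rule bounded_linear_intro[where K = 1])
    (simp_all add: plus_linf_sum_def scaleR_linf_sum_def norm_linf_sum_def)

lemma bounded_linear_LInf_left: "bounded_linear (\<lambda>x. LInf x 0)"
  by (rule bounded_linear_intro[where K = 1])
    (simp_all add: plus_linf_sum_def scaleR_linf_sum_def norm_linf_sum_def)

lemma bounded_linear_LInf_right: "bounded_linear (\<lambda>y. LInf 0 y)"
  by (rule bounded_linear_intro[where K = 1])
    (simp_all add: plus_linf_sum_def scaleR_linf_sum_def norm_linf_sum_def)

lemma BHP_linf_sum:
  assumes "BHP TYPE('a::real_normed_vector)" and "BHP TYPE('b::real_normed_vector)"
  shows "BHP TYPE('a \<oplus>\<^sub>\<infinity> 'b)"
  unfolding BHP_def
proof (intro allI impI)
  fix \<epsilon> :: real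
  assume "\<epsilon> > 0"
  obtain A :: "'a set" where A: "openin (subtopology weak_topology (cball 0 1)) A"
    and "A \<noteq> {}" and diam_A: "diameter A < \<epsilon>"
    using assms(1) \<open>\<epsilon> > 0\<close> unfolding BHP_def by blast
  obtain B :: "'b set" where B: "openin (subtopology weak_topology (cball 0 1)) B"
    and "B \<noteq> {}" and diam_B: "diameter B < \<epsilon>"
    using assms(2) \<open>\<epsilon> > 0\<close> unfolding BHP_def by blast
  obtain V where V: "openin weak_topology V" and A_eq: "A = V \<inter> cball 0 1"
    using A by (auto simp: openin_subtopology)
  obtain W where W: "openin weak_topology W" and B_eq: "B = W \<inter> cball 0 1"
    using B by (auto simp: openin_subtopology)
  \<comment> \<open>The product of \<open>A\<close> and \<open>B\<close>, written with preimages so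
    that weak openness follows from linearity and boundedness of the coordinate maps.\<close>
  define U :: "('a \<oplus>\<^sub>\<infinity> 'b) set" where "U = linf_fst -` A \<inter> linf_snd -` B"
  have "U = (linf_fst -` V \<inter> linf_snd -` W) \<inter> cball 0 1"
    by (auto simp: U_def A_eq B_eq norm_linf_sum_def)
  moreover have "openin weak_topology (linf_fst -` V \<inter> linf_snd -` W :: ('a \<oplus>\<^sub>\<infinity> 'b) set)"
    by (rule openin_Int)
      (use openin_weak_vimage_affine[OF bounded_linear_linf_fst V, of 0]
        openin_weak_vimage_affine[OF bounded_linear_linf_snd W, of 0] in simp_all)
  ultimately have "openin (subtopology weak_topology (cball 0 1)) U"
    unfolding openin_subtopology by blast
  moreover have "U \<noteq> {}"
  proof -
    obtain a b where "a \<in> A" "b \<in> B"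
      using \<open>A \<noteq> {}\<close> \<open>B \<noteq> {}\<close> by blast
    then have "LInf a b \<in> U"
      by (simp add: U_def)
    then show ?thesis
      by blast
  qed
  \<comment> \<open>The norm of a difference is the larger of its coordinate norms, each bounded by
    the diameter of its own factor, so the same \<open>\<epsilon>\<close> serves both
    factors.\<close>
  moreover have "diameter U \<le> max (diameter A) (diameter B)"
  proof (rule diameter_le)
    show "U \<noteq> {} \<or> 0 \<le> max (diameter A) (diameter B)"
      using \<open>U \<noteq> {}\<close> by blast
    have "bounded A" "bounded B"
      unfolding A_eq B_eq by (intro bounded_Int; simp)+
    then show "norm (z - w) \<le> max (diameter A) (diameter B)" if "z \<in> U" "w \<in> U" for z w
      using that diameter_bounded_bound[of A "linf_fst z" "linf_fst w"]
        diameter_bounded_bound[of B "linf_snd z" "linf_snd w"]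
      by (auto simp: U_def norm_linf_sum_def minus_linf_sum_def dist_norm)
  qed
  ultimately show "\<exists>U :: ('a \<oplus>\<^sub>\<infinity> 'b) set. openin (subtopology weak_topology (cball 0 1)) U \<and>
      U \<noteq> {} \<and> diameter U < \<epsilon>"
    using diam_A diam_B by (intro exI[of _ U]) auto
qed

theorem proposition2p11:
  assumes "\<exists>x :: 'a::banach. x \<noteq> 0" and "\<exists>y :: 'b::banach. y \<noteq> 0"
  shows "BHP TYPE('a \<oplus>\<^sub>\<infinity> 'b) \<longleftrightarrow> BHP TYPE('a) \<and> BHP TYPE('b)"
proof
  assume BHP: "BHP TYPE('a \<oplus>\<^sub>\<infinity> 'b)"
  \<comment> \<open>With these choices \<open>c\<close> is \<open>LInf 0 (linf_snd z)\<close>, and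
    the point \<open>T x + c\<close> in \<open>fibre\<close> is \<open>LInf x (linf_snd z)\<close>,
    both of whose coordinates have norm at most 1.\<close>
  have "BHP TYPE('a)"
    by (rule BHP_section[OF BHP bounded_linear_LInf_left, where P = linf_fst])
      (simp_all add: norm_linf_sum_def plus_linf_sum_def minus_linf_sum_def)
  moreover have "BHP TYPE('b)"
    by (rule BHP_section[OF BHP bounded_linear_LInf_right, where P = linf_snd])
      (simp_all add: norm_linf_sum_def plus_linf_sum_def minus_linf_sum_def)
  ultimately show "BHP TYPE('a) \<and> BHP TYPE('b)"
    by blast
qed (simp add: BHP_linf_sum)

end
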